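(* Let $\mathbb{F}$ be a field in which every quadratic and every cubic polynomial has a root, and let $\mathbb{A}$ be a nontrivial two-dimensional algebra over $\mathbb{F}$ with basis $e_1,e_2$ and matrix of structure constants $A=\begin{pmatrix}\alpha_1&\alpha_2&\alpha_3&\alpha_4\\ \beta_1&\beta_2&\beta_3&\beta_4\end{pmatrix}$. The algebra $\mathbb{A}$ is simple, i.e., it has no nontrivial (one-dimensional) two-sided ideal, only in the following cases: 1. $\beta_2\neq\beta_3$ and $\alpha_2=\alpha_3\neq0$; 2. $\beta_2\neq\beta_3$ and $\alpha_2=\alpha_3=0$, $\alpha_4\neq0$; 3. $\alpha_2\neq\alpha_3$ and at least one of $$(\beta_3-\beta_2)^2\alpha_2+(\beta_3-\beta_2)(\alpha_3-\alpha_2)(\alpha_1-\beta_2)-(\alpha_3-\alpha_2)^2\beta_1,$$ $$(\beta_3-\beta_2)^2\alpha_4+(\beta_3-\beta_2)(\alpha_3-\alpha_2)(\alpha_3-\beta_4)-(\alpha_3-\alpha_2)^2\beta_3$$ is not zero. Moreover: - if $\alpha_2=\alpha_3=\alpha_4=0$, then $\mathbb{F}e_2$ is a two-sided ideal of $\mathbb{A}$; - if $\alpha_2\neq\alpha_3$, then $\mathbb{F}\big(e_1+\frac{\beta_3-\beta_2}{\alpha_3-\alpha_2}e_2\big)$ is a two-sided ideal if and only if $$(\beta_3-\beta_2)^2\alpha_2+(\beta_3-\beta_2)(\alpha_3-\alpha_2)(\alpha_1-\beta_2)-(\alpha_3-\alpha_2)^2\beta_1=(\beta_3-\beta_2)^2\alpha_4+(\beta_3-\beta_2)(\alpha_3-\alpha_2)(\alpha_3-\beta_4)-(\alpha_3-\alpha_2)^2\beta_3=0;$$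 - if $\beta_3=\beta_2$ and $\alpha_3=\alpha_2$, then $\mathbb{A}$ is a commutative algebra and every left (right) ideal is two-sided.
   Context: An algebra is a vector space with a bilinear product (not necessarily associative, commutative or unital); it is nontrivial if its product is not identically zero. The matrix of structure constants $A$ in the basis $e_1,e_2$ means $e_1e_1=\alpha_1e_1+\beta_1e_2$, $e_1e_2=\alpha_2e_1+\beta_2e_2$, $e_2e_1=\alpha_3e_1+\beta_3e_2$, $e_2e_2=\alpha_4e_1+\beta_4e_2$. A one-dimensional subspace $\mathbb{F}\mathbf u$ is a left (right) ideal if $\mathbf v\mathbf u\in\mathbb{F}\mathbf u$ (respectively $\mathbf u\mathbf v\in\mathbb{F}\mathbf u$) for all $\mathbf v\in\mathbb{A}$, and a two-sided ideal if it is both.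
   Formalization: The claim that simple algebras occur only in cases 1–3 is restricted to noncommutative algebras: the commutative algebra e1e1=e2, e2e2=e1, e1e2=e2e1=0 is simple but in none of the cases; that each case implies simplicity is kept in full. *)

theory Defs
  imports "HOL-Computational_Algebra.Polynomial" "HOL-Library.Product_Plus"
begin

locale bilinear_algebra = vector_space scale
  for scale :: "'f::field \<Rightarrow> 'v::ab_group_add \<Rightarrow> 'v" +
  fixes mul :: "'v \<Rightarrow> 'v \<Rightarrow> 'v"
  assumes linear_mul_right: "Vector_Spaces.linear scale scale (\<lambda>v. mul u v)"
    and linear_mul_left: "Vector_Spaces.linear scale scale (\<lambda>u. mul u v)"
begin

definition nontrivial_product :: bool where
  "nontrivial_product \<longleftrightarrow> (\<exists>u v. mul u v \<noteq> 0)"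

definition commutative :: bool where
  "commutative \<longleftrightarrow> (\<forall>u v. mul u v = mul v u)"

text \<open>Ideals are here always one-dimensional subspaces.\<close>

definition left_ideal :: "'v set \<Rightarrow> bool" where
  "left_ideal I \<longleftrightarrow> (\<exists>u. u \<noteq> 0 \<and> I = span {u} \<and> (\<forall>v. mul v u \<in> span {u}))"

definition right_ideal :: "'v set \<Rightarrow> bool" where
  "right_ideal I \<longleftrightarrow> (\<exists>u. u \<noteq> 0 \<and> I = span {u} \<and> (\<forall>v. mul u v \<in> span {u}))"

definition two_sided_ideal :: "'v set \<Rightarrow> bool" where
  "two_sided_ideal I \<longleftrightarrow> left_ideal I \<and> right_ideal I"

definition simple_algebra :: bool where
  "simple_algebra \<longleftrightarrow> \<not> (\<exists>I. two_sided_ideal I)"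

definition is_basis2 :: "'v \<Rightarrow> 'v \<Rightarrow> bool" where
  "is_basis2 e1 e2 \<longleftrightarrow> e1 \<noteq> e2 \<and> independent {e1, e2} \<and> span {e1, e2} = UNIV"

end

text \<open>
  A counterexample to reading the list of simple algebras without the restriction to noncommutative
  ones: over every field, the commutative algebra with basis e1, e2 and products
  e1 e1 = e2, e2 e2 = e1, e1 e2 = e2 e1 = 0 has no one-dimensional ideal.
\<close>

definition pair_scale :: "'f::field \<Rightarrow> 'f \<times> 'f \<Rightarrow> 'f \<times> 'f" where
  "pair_scale c u = (c * fst u, c * snd u)"

definition swap_mul :: "'f::field \<times> 'f \<Rightarrow> 'f \<times> 'f \<Rightarrow> 'f \<times> 'f" where
  "swap_mul u v = (snd u * snd v, fst u * fst v)"

lemma bilinear_algebra_swap: "bilinear_algebra (pair_scale :: 'f::field \<Rightarrow> _) swap_mul"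
proof -
  have vs: "vector_space (pair_scale :: 'f \<Rightarrow> _)"
    by unfold_locales (auto simp: pair_scale_def algebra_simps prod_eq_iff)
  show ?thesis
    unfolding bilinear_algebra_def bilinear_algebra_axioms_def Vector_Spaces.linear_def
      module_hom_def module_hom_axioms_def module_iff_vector_space
    using vs by (auto simp: pair_scale_def swap_mul_def algebra_simps)
qed

lemma commutative_simple_example:
  fixes e1 e2 :: "'f::field \<times> 'f"
  defines "e1 \<equiv> (1, 0)" and "e2 \<equiv> (0, 1)"
  shows "swap_mul e1 e1 = e2" "swap_mul e1 e2 = 0" "swap_mul e2 e1 = 0" "swap_mul e2 e2 = e1"
    and "bilinear_algebra.is_basis2 pair_scale e1 e2"
    and "bilinear_algebra.nontrivial_product (swap_mul :: 'f \<times> 'f \<Rightarrow> _)"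
    and "bilinear_algebra.commutative (swap_mul :: 'f \<times> 'f \<Rightarrow> _)"
    and "bilinear_algebra.simple_algebra pair_scale (swap_mul :: 'f \<times> 'f \<Rightarrow> _)"
proof -
  interpret bilinear_algebra "pair_scale :: 'f \<Rightarrow> _" swap_mul
    by (rule bilinear_algebra_swap)
  show m: "swap_mul e1 e1 = e2" "swap_mul e1 e2 = 0" "swap_mul e2 e1 = 0" "swap_mul e2 e2 = e1"
    by (auto simp: swap_mul_def e1_def e2_def zero_prod_def)
  show "nontrivial_product"
    unfolding nontrivial_product_def using m by (metis e2_def zero_neq_one zero_prod_def prod.inject)
  show "commutative"
    unfolding commutative_def by (auto simp: swap_mul_def mult.commute)
  have ne: "e1 \<noteq> e2" by (simp add: e1_def e2_def)
  have s1: "span {u} = range (\<lambda>c. pair_scale c u)" for u :: "'f \<times> 'f"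
    by (rule span_singleton)
  have "u \<in> span {e1, e2}" for u
  proof -
    have "u = pair_scale (fst u) e1 + pair_scale (snd u) e2"
      by (simp add: pair_scale_def e1_def e2_def)
    moreover have "pair_scale (fst u) e1 + pair_scale (snd u) e2 \<in> span {e1, e2}"
      by (intro span_add span_scale span_base) auto
    ultimately show ?thesis by simp
  qed
  moreover have "independent {e1, e2}"
    using ne by (auto simp: independent_insert s1 pair_scale_def e1_def e2_def zero_prod_def)
  ultimately show "is_basis2 e1 e2"
    unfolding is_basis2_def using ne by auto
  show "simple_algebra"
    unfolding simple_algebra_def two_sided_ideal_def left_ideal_def
  proof safe
    fix u :: "'f \<times> 'f"
    assume u: "u \<noteq> 0" and id: "\<forall>v. swap_mul v u \<in> span {u}"
    obtain c where c: "swap_mul e1 u = pair_scale c u" using id s1 by blast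
    obtain d where d: "swap_mul e2 u = pair_scale d u" using id s1 by blast
    from c d u show False
      by (cases u) (auto simp: swap_mul_def pair_scale_def e1_def e2_def zero_prod_def)
  qed
qed

end

theory Submission
  imports Defs
begin

text \<open>
  All commutators are multiples of \<open>w = e\<^sub>1e\<^sub>2 - e\<^sub>2e\<^sub>1\<close>. If \<open>\<F>u\<close> is a two-sided ideal and \<open>v \<notin> \<F>u\<close>, then
  \<open>uv - vu\<close> is a nonzero multiple of \<open>w\<close> lying in \<open>\<F>u\<close>. Hence in a noncommutative algebra, where
  \<open>w \<noteq> 0\<close>, the line \<open>\<F>w\<close> is the only candidate for a two-sided ideal, and it is one
  as soon as it is a left ideal.
\<close>

context bilinear_algebra
begin

lemma mul_add_right: "mul u (v + w) = mul u v + mul u w"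
  and mul_scale_right: "mul u (scale c v) = scale c (mul u v)"
proof -
  interpret l: Vector_Spaces.linear scale scale "\<lambda>v. mul u v" by (rule linear_mul_right)
  show "mul u (v + w) = mul u v + mul u w" "mul u (scale c v) = scale c (mul u v)"
    by (rule l.add, rule l.scale)
qed

lemma mul_add_left: "mul (u + v) w = mul u w + mul v w"
  and mul_scale_left: "mul (scale c u) w = scale c (mul u w)"
proof -
  interpret l: Vector_Spaces.linear scale scale "\<lambda>u. mul u w" by (rule linear_mul_left)
  show "mul (u + v) w = mul u w + mul v w" "mul (scale c u) w = scale c (mul u w)"
    by (rule l.add, rule l.scale)
qed

lemmas mul_simps = mul_add_right mul_scale_right mul_add_left mul_scale_left

lemma span_scale_singleton:
  assumes "c \<noteq> 0"
  shows "span {scale c u} = span {u}"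
  using assms span_image_scale[of "{u}" "\<lambda>_. c"] by simp

lemma span_singleton_eq_scale:
  assumes "span {u} = span {u'}"
  obtains c where "u = scale c u'"
proof -
  have "u \<in> span {u'}" using assms span_base[of u "{u}"] by simp
  then show thesis using that by (auto simp: span_singleton)
qed

text \<open>The definition lets the generator of the line vary. Two generators of the same line are
  proportional, so stability under multiplication can be tested on any one of them.\<close>

lemma left_ideal_span_iff:
  assumes "u \<noteq> 0"
  shows "left_ideal (span {u}) \<longleftrightarrow> (\<forall>v. mul v u \<in> span {u})"
  unfolding left_ideal_def
  using assms by (metis mul_scale_right span_scale span_singleton_eq_scale)

lemma right_ideal_span_iff:
  assumes "u \<noteq> 0"
  shows "right_ideal (span {u}) \<longleftrightarrow> (\<forall>v. mul u v \<in> span {u})"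
  unfolding right_ideal_def
  using assms by (metis mul_scale_left span_scale span_singleton_eq_scale)

lemma commutative_ideals:
  assumes "commutative"
  shows "left_ideal I \<longleftrightarrow> two_sided_ideal I" "right_ideal I \<longleftrightarrow> two_sided_ideal I"
proof -
  have "mul u v = mul v u" for u v using assms by (simp add: commutative_def)
  then have "left_ideal I \<longleftrightarrow> right_ideal I"
    unfolding left_ideal_def right_ideal_def by metis
  then show "left_ideal I \<longleftrightarrow> two_sided_ideal I" "right_ideal I \<longleftrightarrow> two_sided_ideal I"
    by (auto simp: two_sided_ideal_def)
qed

end

locale algebra2 = bilinear_algebra scale mul
  for scale :: "'f::field \<Rightarrow> 'v::ab_group_add \<Rightarrow> 'v" and mul +
  fixes e1 e2 :: 'v
  assumes basis: "is_basis2 e1 e2"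
begin

lemma coords: obtains x y where "v = scale x e1 + scale y e2"
proof -
  have "v \<in> span {e1, e2}" using basis by (simp add: is_basis2_def)
  then obtain x where "v - scale x e1 \<in> span {e2}" by (auto simp: span_insert)
  then obtain y where "v - scale x e1 = scale y e2" by (auto simp: span_singleton)
  then show thesis using that by (metis add.commute diff_add_cancel)
qed

lemma coords_eq_0_iff: "scale x e1 + scale y e2 = 0 \<longleftrightarrow> x = 0 \<and> y = 0"
proof
  assume eq: "scale x e1 + scale y e2 = 0"
  have ne: "e1 \<noteq> e2" and ind: "independent {e1, e2}" using basis by (auto simp: is_basis2_def)
  have e2: "e2 \<noteq> 0" using ind dependent_zero by blast
  have e1: "e1 \<notin> span {e2}" using ind ne by (auto simp: independent_insert)
  have "x = 0"
  proof (rule ccontr)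
    assume "x \<noteq> 0"
    have "scale x e1 = scale (- y) e2"
      using eq by (simp add: eq_neg_iff_add_eq_0)
    then have "scale (inverse x) (scale x e1) \<in> span {e2}"
      by (auto intro: span_scale span_base simp del: scale_minus_left scale_scale)
    with \<open>x \<noteq> 0\<close> e1 show False by simp
  qed
  with eq e2 show "x = 0 \<and> y = 0" by simp
qed simp

lemma coords_eq_iff:
  "scale a e1 + scale b e2 = scale x e1 + scale y e2 \<longleftrightarrow> a = x \<and> b = y"
  using coords_eq_0_iff[of "a - x" "b - y"] by (simp add: scale_left_diff_distrib algebra_simps)

text \<open>In a plane, a vector lies on the line of a nonzero vector iff their determinant
  vanishes. This is what turns the ideal conditions into polynomial identities in the structure
  constants.\<close>

lemma mem_span_coords_iff:
  assumes "x \<noteq> 0 \<or> y \<noteq> 0"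
  shows "scale a e1 + scale b e2 \<in> span {scale x e1 + scale y e2} \<longleftrightarrow> a * y = b * x"
proof -
  have "scale a e1 + scale b e2 \<in> span {scale x e1 + scale y e2} \<longleftrightarrow> (\<exists>k. a = k * x \<and> b = k * y)"
    by (auto simp: span_singleton image_iff scale_right_distrib coords_eq_iff)
  also have "\<dots> \<longleftrightarrow> a * y = b * x"
  proof
    assume eq: "a * y = b * x"
    \<comment> \<open>The factor \<open>k\<close> is read off from a nonzero coordinate of the
      generator.\<close>
    show "\<exists>k. a = k * x \<and> b = k * y"
    proof (cases "x = 0")
      case True
      with assms eq show ?thesis by (intro exI[of _ "b / y"]) auto
    next
      case False
      with eq show ?thesis by (intro exI[of _ "a / x"]) (auto simp: field_simps)
    qed
  qed (auto simp: algebra_simps)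
  finally show ?thesis .
qed

definition w where "w = mul e1 e2 - mul e2 e1"

text \<open>The commutator is bilinear and alternating, so in dimension two it is the determinant of
  the coordinates times its value \<open>w\<close> on the basis.\<close>

lemma commutator_coords:
  "mul (scale x e1 + scale y e2) (scale a e1 + scale b e2)
    - mul (scale a e1 + scale b e2) (scale x e1 + scale y e2) = scale (x * b - y * a) w"
  by (simp add: mul_simps w_def algebra_simps scale_left_diff_distrib scale_right_diff_distrib)

lemma commutative_iff: "commutative \<longleftrightarrow> w = 0"
proof
  assume "w = 0"
  then have "mul u v - mul v u = 0" for u v
    using coords[of u] coords[of v] commutator_coords by (metis scale_zero_right)
  then show "commutative" by (simp add: commutative_def)
qed (simp add: commutative_def w_def)

lemma left_stable_iff: "(\<forall>v. mul v u \<in> span S) \<longleftrightarrow> mul e1 u \<in> span S \<and> mul e2 u \<in> span S"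
proof safe
  fix v assume "mul e1 u \<in> span S" "mul e2 u \<in> span S"
  moreover obtain x y where "v = scale x e1 + scale y e2" by (rule coords)
  ultimately show "mul v u \<in> span S" by (simp add: mul_simps span_add span_scale)
qed auto

lemma two_sided_ideal_imp_w:
  assumes "two_sided_ideal I" "w \<noteq> 0"
  shows "I = span {w}"
proof -
  obtain u where u: "u \<noteq> 0" and I: "I = span {u}" and l: "\<forall>v. mul v u \<in> span {u}"
    using assms(1) unfolding two_sided_ideal_def left_ideal_def by blast
  \<comment> \<open>The left and right ideal properties may come with different generators; here the
    right one is moved to the same \<open>u\<close>.\<close>
  have r: "\<forall>v. mul u v \<in> span {u}"
    using assms(1) u by (simp add: I two_sided_ideal_def right_ideal_span_iff)
  obtain x y where xy: "u = scale x e1 + scale y e2" by (rule coords)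
  \<comment> \<open>A vector off the line of \<open>u\<close> is needed: \<open>e1\<close> serves if
    \<open>x = 0\<close>, and \<open>e2\<close> otherwise.\<close>
  obtain a b where ab: "x * b - y * a \<noteq> 0"
  proof (cases "x = 0")
    case True
    with u xy have "x * 0 - y * 1 \<noteq> 0" by auto
    then show thesis by (rule that)
  next
    case False
    then have "x * 1 - y * 0 \<noteq> 0" by simp
    then show thesis by (rule that)
  qed
  have "scale (x * b - y * a) w \<in> span {u}"
    using l r span_diff unfolding xy commutator_coords[symmetric] by blast
  then obtain k where k: "scale (x * b - y * a) w = scale k u" by (auto simp: span_singleton)
  \<comment> \<open>Both factors are nonzero, so \<open>w\<close> and \<open>u\<close> span the same
    line.\<close>
  with ab assms(2) have "k \<noteq> 0" by auto
  with k ab show ?thesis unfolding I by (metis span_scale_singleton)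
qed

text \<open>Since \<open>mul w v\<close> and \<open>mul v w\<close> differ by a multiple of
  \<open>w\<close>, stability on the left gives stability on the right, and by linearity the left
  factor need only run over the basis.\<close>

lemma two_sided_ideal_w_iff:
  assumes "w \<noteq> 0"
  shows "two_sided_ideal (span {w}) \<longleftrightarrow> mul e1 w \<in> span {w} \<and> mul e2 w \<in> span {w}"
proof -
  have "mul w v \<in> span {w}" if "mul v w \<in> span {w}" for v
  proof -
    obtain x y where "w = scale x e1 + scale y e2" by (rule coords)
    moreover obtain a b where "v = scale a e1 + scale b e2" by (rule coords)
    ultimately have "mul w v = scale (x * b - y * a) w + mul v w"
      by (metis commutator_coords diff_add_cancel)
    then show ?thesis using that by (simp add: span_add span_scale span_base)
  qed
  then show ?thesis
    using assms left_stable_iff[of w "{w}"]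
    by (auto simp: two_sided_ideal_def left_ideal_span_iff right_ideal_span_iff)
qed

lemma simple_iff:
  assumes "w \<noteq> 0"
  shows "simple_algebra \<longleftrightarrow> \<not> two_sided_ideal (span {w})"
  unfolding simple_algebra_def using two_sided_ideal_imp_w[OF _ assms] by auto

end

text \<open>The list of cases characterizes the simple algebras that are not commutative: each case
  forces \<open>w\<close> to be nonzero, whereas a commutative algebra can be simple as well, as
  \<open>swap_mul\<close> shows.\<close>

theorem proposition7p1:
  fixes scale :: "'f::field \<Rightarrow> 'v::ab_group_add \<Rightarrow> 'v"
    and mul :: "'v \<Rightarrow> 'v \<Rightarrow> 'v"
    and e1 e2 :: 'v
    and \<alpha>\<^sub>1 \<alpha>\<^sub>2 \<alpha>\<^sub>3 \<alpha>\<^sub>4 \<beta>\<^sub>1 \<beta>\<^sub>2 \<beta>\<^sub>3 \<beta>\<^sub>4 :: 'f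
  assumes roots: "\<forall>p :: 'f poly. degree p = 2 \<or> degree p = 3 \<longrightarrow> (\<exists>x. poly p x = 0)"
    and alg: "bilinear_algebra scale mul"
    and nontriv: "bilinear_algebra.nontrivial_product mul"
    and basis: "bilinear_algebra.is_basis2 scale e1 e2"
    and e11: "mul e1 e1 = scale \<alpha>\<^sub>1 e1 + scale \<beta>\<^sub>1 e2"
    and e12: "mul e1 e2 = scale \<alpha>\<^sub>2 e1 + scale \<beta>\<^sub>2 e2"
    and e21: "mul e2 e1 = scale \<alpha>\<^sub>3 e1 + scale \<beta>\<^sub>3 e2"
    and e22: "mul e2 e2 = scale \<alpha>\<^sub>4 e1 + scale \<beta>\<^sub>4 e2"
  shows "(bilinear_algebra.simple_algebra scale mul \<and> \<not> bilinear_algebra.commutative mul \<longleftrightarrow>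
      (\<beta>\<^sub>2 \<noteq> \<beta>\<^sub>3 \<and> \<alpha>\<^sub>2 = \<alpha>\<^sub>3 \<and> \<alpha>\<^sub>3 \<noteq> 0) \<or>
      (\<beta>\<^sub>2 \<noteq> \<beta>\<^sub>3 \<and> \<alpha>\<^sub>2 = \<alpha>\<^sub>3 \<and> \<alpha>\<^sub>3 = 0 \<and> \<alpha>\<^sub>4 \<noteq> 0) \<or>
      (\<alpha>\<^sub>2 \<noteq> \<alpha>\<^sub>3 \<and>
        ((\<beta>\<^sub>3 - \<beta>\<^sub>2)^2 * \<alpha>\<^sub>2 + (\<beta>\<^sub>3 - \<beta>\<^sub>2) * (\<alpha>\<^sub>3 - \<alpha>\<^sub>2) * (\<alpha>\<^sub>1 - \<beta>\<^sub>2) - (\<alpha>\<^sub>3 - \<alpha>\<^sub>2)^2 * \<beta>\<^sub>1 \<noteq> 0 \<or>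
         (\<beta>\<^sub>3 - \<beta>\<^sub>2)^2 * \<alpha>\<^sub>4 + (\<beta>\<^sub>3 - \<beta>\<^sub>2) * (\<alpha>\<^sub>3 - \<alpha>\<^sub>2) * (\<alpha>\<^sub>3 - \<beta>\<^sub>4) - (\<alpha>\<^sub>3 - \<alpha>\<^sub>2)^2 * \<beta>\<^sub>3 \<noteq> 0)))
    \<and> (\<alpha>\<^sub>2 = 0 \<and> \<alpha>\<^sub>3 = 0 \<and> \<alpha>\<^sub>4 = 0 \<longrightarrow>
      bilinear_algebra.two_sided_ideal scale mul (module.span scale {e2}))
    \<and> (\<alpha>\<^sub>2 \<noteq> \<alpha>\<^sub>3 \<longrightarrow>
      (bilinear_algebra.two_sided_ideal scale mul
        (module.span scale {e1 + scale ((\<beta>\<^sub>3 - \<beta>\<^sub>2) / (\<alpha>\<^sub>3 - \<alpha>\<^sub>2)) e2}) \<longleftrightarrow>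
      (\<beta>\<^sub>3 - \<beta>\<^sub>2)^2 * \<alpha>\<^sub>2 + (\<beta>\<^sub>3 - \<beta>\<^sub>2) * (\<alpha>\<^sub>3 - \<alpha>\<^sub>2) * (\<alpha>\<^sub>1 - \<beta>\<^sub>2) - (\<alpha>\<^sub>3 - \<alpha>\<^sub>2)^2 * \<beta>\<^sub>1 = 0 \<and>
      (\<beta>\<^sub>3 - \<beta>\<^sub>2)^2 * \<alpha>\<^sub>4 + (\<beta>\<^sub>3 - \<beta>\<^sub>2) * (\<alpha>\<^sub>3 - \<alpha>\<^sub>2) * (\<alpha>\<^sub>3 - \<beta>\<^sub>4) - (\<alpha>\<^sub>3 - \<alpha>\<^sub>2)^2 * \<beta>\<^sub>3 = 0))
    \<and> (\<beta>\<^sub>3 = \<beta>\<^sub>2 \<and> \<alpha>\<^sub>3 = \<alpha>\<^sub>2 \<longrightarrow>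
      bilinear_algebra.commutative mul \<and>
      (\<forall>I. bilinear_algebra.left_ideal scale mul I \<longrightarrow> bilinear_algebra.two_sided_ideal scale mul I) \<and>
      (\<forall>I. bilinear_algebra.right_ideal scale mul I \<longrightarrow> bilinear_algebra.two_sided_ideal scale mul I))"
proof -
  interpret algebra2 scale mul e1 e2
    using alg basis by (simp add: algebra2_def algebra2_axioms_def)
  let ?P = "(\<beta>\<^sub>3 - \<beta>\<^sub>2)^2 * \<alpha>\<^sub>2 + (\<beta>\<^sub>3 - \<beta>\<^sub>2) * (\<alpha>\<^sub>3 - \<alpha>\<^sub>2) * (\<alpha>\<^sub>1 - \<beta>\<^sub>2) - (\<alpha>\<^sub>3 - \<alpha>\<^sub>2)^2 * \<beta>\<^sub>1"
  let ?Q = "(\<beta>\<^sub>3 - \<beta>\<^sub>2)^2 * \<alpha>\<^sub>4 + (\<beta>\<^sub>3 - \<beta>\<^sub>2) * (\<alpha>\<^sub>3 - \<alpha>\<^sub>2) * (\<alpha>\<^sub>3 - \<beta>\<^sub>4) - (\<alpha>\<^sub>3 - \<alpha>\<^sub>2)^2 * \<beta>\<^sub>3"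
  \<comment> \<open>Up to sign, \<open>d\<close> and \<open>s\<close> are the coordinates of
    \<open>w\<close>; the sign arises because the stated differences belong to
    \<open>mul e2 e1 - mul e1 e2\<close>.\<close>
  define d where "d = \<alpha>\<^sub>3 - \<alpha>\<^sub>2"
  define s where "s = \<beta>\<^sub>3 - \<beta>\<^sub>2"
  have w: "w = scale (- d) e1 + scale (- s) e2"
    by (simp add: w_def e12 e21 d_def s_def algebra_simps scale_left_diff_distrib)
  have w0: "w = 0 \<longleftrightarrow> d = 0 \<and> s = 0"
    unfolding w coords_eq_0_iff by simp
  have e1w: "mul e1 w = scale (- (d * \<alpha>\<^sub>1) - s * \<alpha>\<^sub>2) e1 + scale (- (d * \<beta>\<^sub>1) - s * \<beta>\<^sub>2) e2"
    and e2w: "mul e2 w = scale (- (d * \<alpha>\<^sub>3) - s * \<alpha>\<^sub>4) e1 + scale (- (d * \<beta>\<^sub>3) - s * \<beta>\<^sub>4) e2"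
    unfolding w mul_simps e11 e12 e21 e22
    by (simp_all add: algebra_simps scale_left_diff_distrib)
  \<comment> \<open>The equations say that \<open>mul e1 w\<close> and \<open>mul e2 w\<close> are
    proportional to \<open>w\<close>. The two determinants involved expand to \<open>?P\<close> and
    \<open>?Q\<close>.\<close>
  have "two_sided_ideal (span {w}) \<longleftrightarrow>
      (- (d * \<alpha>\<^sub>1) - s * \<alpha>\<^sub>2) * (- s) = (- (d * \<beta>\<^sub>1) - s * \<beta>\<^sub>2) * (- d) \<and>
      (- (d * \<alpha>\<^sub>3) - s * \<alpha>\<^sub>4) * (- s) = (- (d * \<beta>\<^sub>3) - s * \<beta>\<^sub>4) * (- d)" if "w \<noteq> 0"
    using that w0 unfolding two_sided_ideal_w_iff[OF that] e1w e2w
    unfolding w by (subst (1 2) mem_span_coords_iff) auto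
  moreover have "(- (d * \<alpha>\<^sub>1) - s * \<alpha>\<^sub>2) * (- s) - (- (d * \<beta>\<^sub>1) - s * \<beta>\<^sub>2) * (- d) = ?P"
    "(- (d * \<alpha>\<^sub>3) - s * \<alpha>\<^sub>4) * (- s) - (- (d * \<beta>\<^sub>3) - s * \<beta>\<^sub>4) * (- d) = ?Q"
    unfolding d_def[symmetric] s_def[symmetric] by algebra+
  ultimately have ideal_w: "two_sided_ideal (span {w}) \<longleftrightarrow> ?P = 0 \<and> ?Q = 0" if "w \<noteq> 0"
    using that by (metis eq_iff_diff_eq_0)

  \<comment> \<open>Noncommutativity means that \<open>w\<close> is nonzero, and then simplicity
    fails exactly when the line of \<open>w\<close> is an ideal.\<close>
  have simple: "simple_algebra \<and> \<not> commutative \<longleftrightarrow>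
      (d \<noteq> 0 \<or> s \<noteq> 0) \<and> (?P \<noteq> 0 \<or> ?Q \<noteq> 0)"
    using simple_iff ideal_w commutative_iff w0 by auto
  have 1: "simple_algebra \<and> \<not> commutative \<longleftrightarrow>
      (\<beta>\<^sub>2 \<noteq> \<beta>\<^sub>3 \<and> \<alpha>\<^sub>2 = \<alpha>\<^sub>3 \<and> \<alpha>\<^sub>3 \<noteq> 0) \<or>
      (\<beta>\<^sub>2 \<noteq> \<beta>\<^sub>3 \<and> \<alpha>\<^sub>2 = \<alpha>\<^sub>3 \<and> \<alpha>\<^sub>3 = 0 \<and> \<alpha>\<^sub>4 \<noteq> 0) \<or>
      (\<alpha>\<^sub>2 \<noteq> \<alpha>\<^sub>3 \<and> (?P \<noteq> 0 \<or> ?Q \<noteq> 0))"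
  proof (cases "\<alpha>\<^sub>2 = \<alpha>\<^sub>3")
    \<comment> \<open>Here \<open>d = 0\<close>, so \<open>?P\<close> and \<open>?Q\<close> reduce
      to \<open>s^2 * \<alpha>\<^sub>2\<close> and \<open>s^2 * \<alpha>\<^sub>4\<close>. With
      \<open>s\<close> nonzero, one of them survives exactly in the first two cases.\<close>
    case True
    then show ?thesis unfolding simple d_def s_def by auto
  next
    case False
    then show ?thesis unfolding simple d_def s_def by simp
  qed

  have e2: "e2 \<noteq> 0" using coords_eq_0_iff[of 0 1] by simp
  have 2: "two_sided_ideal (span {e2})" if "\<alpha>\<^sub>2 = 0" "\<alpha>\<^sub>3 = 0" "\<alpha>\<^sub>4 = 0"
  proof -
    \<comment> \<open>The three vanishing constants make \<open>mul e1 e2\<close>,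
      \<open>mul e2 e1\<close> and \<open>mul e2 e2\<close> multiples of \<open>e2\<close>.\<close>
    have "mul v e2 \<in> span {e2} \<and> mul e2 v \<in> span {e2}" for v
    proof -
      obtain x y where "v = scale x e1 + scale y e2" by (rule coords)
      then show ?thesis
        by (simp add: mul_simps e12 e21 e22 that span_add span_scale span_base)
    qed
    with e2 show ?thesis
      by (simp add: two_sided_ideal_def left_ideal_span_iff right_ideal_span_iff)
  qed

  have 3: "two_sided_ideal (span {e1 + scale (s / d) e2}) \<longleftrightarrow> ?P = 0 \<and> ?Q = 0" if "d \<noteq> 0"
  proof -
    \<comment> \<open>The generator in the statement is \<open>w\<close> rescaled to have first
      coordinate 1.\<close>
    have "w = scale (- d) (e1 + scale (s / d) e2)"
      using that by (simp add: w scale_right_distrib)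
    then have "span {w} = span {e1 + scale (s / d) e2}"
      using that span_scale_singleton[of "- d"] by (metis neg_equal_0_iff_equal)
    then show ?thesis using ideal_w w0 that by simp
  qed

  have 4: "commutative" if "\<beta>\<^sub>3 = \<beta>\<^sub>2" "\<alpha>\<^sub>3 = \<alpha>\<^sub>2"
    using that by (simp add: commutative_iff w0 d_def s_def)
  show ?thesis
    using 1 2 3[unfolded d_def s_def] 4 commutative_ideals by auto
qed

end
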